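(* Let $n\ge2$ and let $\widetilde W$ be the extended affine Weyl group of type $\mathsf B_n^{(1)}$. Let $1\le i\le n$. If $i$ is odd, then $$\omega_i=\pi_1[1,n]\big(s_0[2,n][1,n]\big)^{(i-1)/2}[n-i,n-1]\cdots[1,i].$$ If $i$ is even, then $$\omega_i=\big(s_0[2,n][1,n]\big)^{i/2}[n-i,n-1]\cdots[1,i].$$ (For $i=n$ the factor $[n-i,n-1]\cdots[1,i]$ is empty, i.e. equal to $1$.) Moreover, the formulae above yield reduced expressions.
   Context: Let $\mathfrak g$ be the simple Lie algebra of type $\mathsf B_n$ (Bourbaki labelling: $\alpha_j=e_j-e_{j+1}$ for $j\le n-1$, $\alpha_n=e_n$), $\theta=e_1+e_2=\alpha_1+2\sum_{i=2}^n\alpha_i$ its highest root, $\delta$ the basic imaginary root and $\alpha_0=\delta-\theta$. The affine Weyl group $W=\langle s_0,\dots,s_n\rangle$ is generated by the simple reflections of the untwisted affine root system, acting on $\bigoplus_{i=0}^n\mathbb Z\alpha_i$. The extended affine Weyl group $\widetilde W$ is the semidirect product of $W_0=\langle s_1,\dots,s_n\rangle$ with the lattice of translations with basis $\omega_1,\dots,\omega_n$, where, as an element of $\widetilde W$, $\omega_i$ acts on $\mathbb R^n$ as translation by $e_1+\cdots+e_i$ (the $i$-th fundamental weight of the dual type $\mathsf C_n$) and $s_0$ acts as $t_{\theta^\vee}r_\theta$ (reflection $r_\theta$ in $\theta$ followed by translation by $\theta^\vee=e_1+e_2$). Equivalently, on roots, $\omega_i(\alpha_j)=\alpha_j-\delta_{ij}\delta$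 ($1\le j\le n$), $\omega_i(\delta)=\delta$. One has $\widetilde W=\Lambda\ltimes W$ with $\Lambda=\{1,\pi_1\}$, where $\pi_1$ is the diagram automorphism interchanging $\alpha_0$ and $\alpha_1$ and fixing the other $\alpha_j$. The length satisfies $\ell(\lambda w)=\ell(w)$ for $\lambda\in\Lambda$, $w\in W$; an expression $\lambda s_{i_1}\cdots s_{i_r}$ is reduced if $r=\ell(\lambda s_{i_1}\cdots s_{i_r})$. Notation: $[k,l]=s_ks_{k+1}\cdots s_l$ for $1\le k\le l$; for $i<n$, $[n-i,n-1]\cdots[1,i]$ denotes $[n-i,n-1][n-i-1,n-2]\cdots[2,i+1][1,i]$. *)

theory Defs
  imports Complex_Main "HOL-Algebra.Bij" "HOL-Algebra.Generated_Groups"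
begin

text \<open>
  Everything is realised inside the group of bijections of Euclidean n-space, whose
  coordinates are numbered from 1 to n; a vector is a function on the natural numbers
  that vanishes outside these coordinates.
\<close>

definition Rn :: "nat \<Rightarrow> (nat \<Rightarrow> real) set" where
  "Rn n = {x. \<forall>k. k \<notin> {1..n} \<longrightarrow> x k = 0}"

type_synonym transf = "(nat \<Rightarrow> real) \<Rightarrow> (nat \<Rightarrow> real)"

abbreviation Aff :: "nat \<Rightarrow> transf monoid" where
  "Aff n \<equiv> BijGroup (Rn n)"

definition inner_prod :: "nat \<Rightarrow> (nat \<Rightarrow> real) \<Rightarrow> (nat \<Rightarrow> real) \<Rightarrow> real" where
  "inner_prod n x y = (\<Sum>k=1..n. x k * y k)"

definition unit_vec :: "nat \<Rightarrow> nat \<Rightarrow> real" where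
  "unit_vec j = (\<lambda>k. if k = j then 1 else 0)"

definition simple_root :: "nat \<Rightarrow> nat \<Rightarrow> nat \<Rightarrow> real" where
  "simple_root n j =
     (if j < n then (\<lambda>k. unit_vec j k - unit_vec (j + 1) k) else unit_vec n)"

definition highest_root :: "nat \<Rightarrow> real" where
  "highest_root = (\<lambda>k. unit_vec 1 k + unit_vec 2 k)"

definition coroot :: "nat \<Rightarrow> (nat \<Rightarrow> real) \<Rightarrow> nat \<Rightarrow> real" where
  "coroot n \<beta> = (\<lambda>k. 2 * \<beta> k / inner_prod n \<beta> \<beta>)"

definition reflection :: "nat \<Rightarrow> (nat \<Rightarrow> real) \<Rightarrow> transf" where
  "reflection n \<beta> = (\<lambda>x\<in>Rn n. \<lambda>k. x k - inner_prod n \<beta> x * coroot n \<beta> k)"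

definition translation :: "nat \<Rightarrow> (nat \<Rightarrow> real) \<Rightarrow> transf" where
  "translation n v = (\<lambda>x\<in>Rn n. \<lambda>k. x k + v k)"

definition simple_refl :: "nat \<Rightarrow> nat \<Rightarrow> transf" where
  "simple_refl n j =
     (if j = 0
      then translation n (coroot n highest_root) \<otimes>\<^bsub>Aff n\<^esub> reflection n highest_root
      else reflection n (simple_root n j))"

definition omega :: "nat \<Rightarrow> nat \<Rightarrow> transf" where
  "omega n i = translation n (\<lambda>k. \<Sum>j=1..i. unit_vec j k)"

definition fin_weyl :: "nat \<Rightarrow> transf set" where
  "fin_weyl n = generate (Aff n) (simple_refl n ` {1..n})"

definition aff_weyl :: "nat \<Rightarrow> transf set" where
  "aff_weyl n = generate (Aff n) (simple_refl n ` {0..n})"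

definition transl_lattice :: "nat \<Rightarrow> transf set" where
  "transl_lattice n = generate (Aff n) (omega n ` {1..n})"

text \<open>The semidirect product of the finite Weyl group and the lattice, as an internal product.\<close>

definition ext_weyl :: "nat \<Rightarrow> transf monoid" where
  "ext_weyl n = (Aff n)\<lparr>carrier := transl_lattice n <#>\<^bsub>Aff n\<^esub> fin_weyl n\<rparr>"

text \<open>
  An affine root \<open>\<beta> + m \<delta>\<close> is the affine function \<open>x \<mapsto> (\<beta>, x) + m\<close>, and a
  transformation \<open>g\<close> sends the function \<open>f\<close> to \<open>f \<circ> g\<inverse>\<close>. This is the action on roots for
  which \<open>\<omega>\<^sub>i\<close> maps \<open>\<alpha>\<^sub>i\<close> to \<open>\<alpha>\<^sub>i - \<delta>\<close>.
\<close>

definition affine_simple_root :: "nat \<Rightarrow> nat \<Rightarrow> (nat \<Rightarrow> real) \<Rightarrow> real" where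
  "affine_simple_root n j =
     (\<lambda>x\<in>Rn n. if j = 0 then 1 - inner_prod n highest_root x
                else inner_prod n (simple_root n j) x)"

definition root_action ::
    "nat \<Rightarrow> transf \<Rightarrow> ((nat \<Rightarrow> real) \<Rightarrow> real) \<Rightarrow> (nat \<Rightarrow> real) \<Rightarrow> real" where
  "root_action n g f = (\<lambda>x\<in>Rn n. f ((inv\<^bsub>Aff n\<^esub> g) x))"

definition pi1 :: "nat \<Rightarrow> transf" where
  "pi1 n = (THE g. g \<in> carrier (ext_weyl n)
      \<and> root_action n g (affine_simple_root n 0) = affine_simple_root n 1
      \<and> root_action n g (affine_simple_root n 1) = affine_simple_root n 0
      \<and> (\<forall>j\<in>{2..n}. root_action n g (affine_simple_root n j) = affine_simple_root n j))"

definition Lambda :: "nat \<Rightarrow> transf set" where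
  "Lambda n = {\<one>\<^bsub>ext_weyl n\<^esub>, pi1 n}"

text \<open>Words in the simple reflections are lists of indices from 0 to n.\<close>

definition word_prod :: "nat \<Rightarrow> nat list \<Rightarrow> transf" where
  "word_prod n js = foldr (\<otimes>\<^bsub>ext_weyl n\<^esub>) (map (simple_refl n) js) \<one>\<^bsub>ext_weyl n\<^esub>"

definition coxeter_length :: "nat \<Rightarrow> transf \<Rightarrow> nat" where
  "coxeter_length n w =
     (LEAST r. \<exists>js. set js \<subseteq> {0..n} \<and> length js = r \<and> word_prod n js = w)"

definition ext_length :: "nat \<Rightarrow> transf \<Rightarrow> nat" where
  "ext_length n g = coxeter_length n
     (THE w. w \<in> aff_weyl n \<and> (\<exists>u\<in>Lambda n. g = u \<otimes>\<^bsub>ext_weyl n\<^esub> w))"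

definition reduced_expr :: "nat \<Rightarrow> transf \<Rightarrow> nat list \<Rightarrow> bool" where
  "reduced_expr n u js \<longleftrightarrow> u \<in> Lambda n \<and> set js \<subseteq> {0..n} \<and>
     length js = ext_length n (u \<otimes>\<^bsub>ext_weyl n\<^esub> word_prod n js)"

definition seg :: "nat \<Rightarrow> nat \<Rightarrow> nat list" where
  "seg k l = [k..<Suc l]"

text \<open>
  The word \<open>[n-i,n-1] [n-i-1,n-2] \<dots> [1,i]\<close>: the left end \<open>k\<close> of the segments decreases
  from \<open>n-i\<close> to 1. For \<open>i = n\<close> it is empty.
\<close>

definition staircase :: "nat \<Rightarrow> nat \<Rightarrow> nat list" where
  "staircase n i = concat (map (\<lambda>k. seg k (k + i - 1)) (rev [1..<Suc (n - i)]))"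

definition block_power :: "nat \<Rightarrow> nat \<Rightarrow> nat list" where
  "block_power n m = concat (replicate m ([0] @ seg 2 n @ seg 1 n))"

end

theory Submission
  imports Defs "HOL-Combinatorics.Transposition"
begin

text \<open>
  Written in coordinates, every simple reflection is a signed permutation of the coordinates,
  followed for \<open>s\<^sub>0\<close> by a translation, and \<open>\<pi>\<^sub>1\<close> replaces \<open>x\<^sub>1\<close> by \<open>1 - x\<^sub>1\<close>. The segments are
  cyclic shifts, and \<open>s\<^sub>0 [2,n] [1,n]\<close> rotates the coordinates by two places and adds 1 to the
  two that wrap around; this gives the formulae for \<open>\<omega>\<^sub>i\<close>.

  For reducedness, the number of affine root hyperplanes that separate two points is a
  pseudometric invariant under the extended affine Weyl group. A simple reflection moves a point
  \<open>p\<close> of the fundamental alcove across exactly one hyperplane, so a word of length \<open>r\<close> moves \<open>p\<close>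
  across at most \<open>r\<close> of them, while \<open>\<omega>\<^sub>i\<close> moves \<open>p\<close> across \<open>i (2n - i)\<close> hyperplanes, which is the
  number of letters in the formula. The decomposition that defines the length is unique because
  \<open>\<pi>\<^sub>1\<close> is not in the affine Weyl group: elements of the latter preserve the set of integral
  vectors with even coordinate sum, whereas \<open>\<pi>\<^sub>1\<close> maps 0 to \<open>e\<^sub>1\<close>.
\<close>

section \<open>Simple reflections in coordinates, and words as compositions of coordinate
  maps\<close>

lemma sum_unit_vec_mult:
  "(\<Sum>k=1..n. unit_vec j k * x k) = (if j \<in> {1..n} then x j else 0)"
  unfolding unit_vec_def by (simp add: if_distrib [of "\<lambda>c. c * _"] cong: if_cong)

text \<open>The case \<open>j = n\<close> fits the same formula because vectors of
  \<open>Rn n\<close> vanish at place \<open>n + 1\<close>. This lets later telescoping arguments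
  avoid a separate last step.\<close>

lemma inner_prod_simple_root:
  assumes "j \<in> {1..n}" "x \<in> Rn n"
  shows "inner_prod n (simple_root n j) x = x j - x (j + 1)"
proof (cases "j < n")
  case True
  then show ?thesis
    using assms sum_unit_vec_mult[of j x n] sum_unit_vec_mult[of "j + 1" x n]
    by (simp add: inner_prod_def simple_root_def left_diff_distrib sum_subtractf)
next
  case False
  then show ?thesis
    using assms sum_unit_vec_mult[of n x n]
    by (auto simp: inner_prod_def simple_root_def Rn_def)
qed

lemma inner_prod_highest_root:
  assumes "n \<ge> 2"
  shows "inner_prod n highest_root x = x 1 + x 2"
  using assms sum_unit_vec_mult[of 1 x n] sum_unit_vec_mult[of 2 x n]
  by (simp add: inner_prod_def highest_root_def distrib_right sum.distrib)

lemma simple_root_in_Rn: "j \<in> {1..n} \<Longrightarrow> simple_root n j \<in> Rn n"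
  by (auto simp: Rn_def simple_root_def unit_vec_def)

lemma highest_root_in_Rn: "n \<ge> 2 \<Longrightarrow> highest_root \<in> Rn n"
  by (auto simp: Rn_def highest_root_def unit_vec_def)

text \<open>Total rather than restricted to \<open>Rn n\<close>, so that words can be evaluated by
  \<open>foldr\<close> without side conditions on the domain. The case \<open>j = 0\<close> is the
  reflection in the hyperplane \<open>x 1 + x 2 = 1\<close>.\<close>

definition gen :: "nat \<Rightarrow> nat \<Rightarrow> transf" where
  "gen n j x = (if j = 0 then x(1 := 1 - x 2, 2 := 1 - x 1)
     else if j < n then x(j := x (j + 1), j + 1 := x j) else x(n := - x n))"

lemma reflection_simple_root:
  assumes "j \<in> {1..n}"
  shows "reflection n (simple_root n j) = restrict (gen n j) (Rn n)"
proof -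
  \<comment> \<open>The short root has square length 1, so its coroot is twice the root; the long
    simple roots coincide with their coroots.\<close>
  have norm: "inner_prod n (simple_root n j) (simple_root n j) = (if j < n then 2 else 1)"
    using assms by (simp add: inner_prod_simple_root simple_root_in_Rn)
      (auto simp: simple_root_def unit_vec_def)
  have "x k - (x j - x (j + 1)) * coroot n (simple_root n j) k = gen n j x k"
    if "x \<in> Rn n" for x k
    using assms that unfolding coroot_def norm
    by (auto simp: gen_def simple_root_def unit_vec_def Rn_def field_simps)
  then show ?thesis
    using assms
    by (auto simp: reflection_def inner_prod_simple_root intro!: restrict_ext)
qed

lemma coroot_highest_root: "n \<ge> 2 \<Longrightarrow> coroot n highest_root = highest_root"
  by (auto simp: coroot_def inner_prod_highest_root) (auto simp: highest_root_def unit_vec_def)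

lemma gen_in_Rn: "n \<ge> 2 \<Longrightarrow> j \<le> n \<Longrightarrow> x \<in> Rn n \<Longrightarrow> gen n j x \<in> Rn n"
  by (auto simp: Rn_def gen_def)

lemma gen_gen: "n \<ge> 2 \<Longrightarrow> gen n j (gen n j x) = x"
  by (auto simp: gen_def)

lemma involution_in_Aff:
  assumes "\<And>x. x \<in> Rn n \<Longrightarrow> f x \<in> Rn n" "\<And>x. x \<in> Rn n \<Longrightarrow> f (f x) = x"
  shows "restrict f (Rn n) \<in> carrier (Aff n)"
  unfolding BijGroup_def Bij_def
  using assms by (auto intro!: bij_betw_byWitness[where f' = f])

lemma translation_in_Aff:
  assumes "v \<in> Rn n"
  shows "translation n v \<in> carrier (Aff n)"
proof -
  have "bij_betw (translation n v) (Rn n) (Rn n)"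
    by (rule bij_betw_byWitness[where f' = "\<lambda>x k. x k - v k"])
      (use assms in \<open>auto simp: translation_def Rn_def\<close>)
  then show ?thesis
    by (simp add: BijGroup_def Bij_def translation_def)
qed

lemma Aff_mult: "f \<in> carrier (Aff n) \<Longrightarrow> g \<in> carrier (Aff n) \<Longrightarrow> f \<otimes>\<^bsub>Aff n\<^esub> g = compose (Rn n) f g"
  by (simp add: BijGroup_def)

lemma Aff_one: "\<one>\<^bsub>Aff n\<^esub> = restrict (\<lambda>x. x) (Rn n)"
  by (simp add: BijGroup_def)

lemma Aff_into: "f \<in> carrier (Aff n) \<Longrightarrow> x \<in> Rn n \<Longrightarrow> f x \<in> Rn n"
  by (auto simp: BijGroup_def Bij_def bij_betw_def)

lemma Aff_eqI:
  assumes "f \<in> carrier (Aff n)" "g \<in> carrier (Aff n)" "\<And>x. x \<in> Rn n \<Longrightarrow> f x = g x"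
  shows "f = g"
  using assms by (auto simp: BijGroup_def Bij_def intro: extensionalityI)

interpretation Aff: group "Aff n" for n
  by (rule group_BijGroup)

lemma ext_weyl_simps [simp]:
  "mult (ext_weyl n) = mult (Aff n)" "one (ext_weyl n) = one (Aff n)"
  by (simp_all add: ext_weyl_def)

lemma gen_in_Aff: "n \<ge> 2 \<Longrightarrow> j \<le> n \<Longrightarrow> restrict (gen n j) (Rn n) \<in> carrier (Aff n)"
  by (intro involution_in_Aff) (auto simp: gen_in_Rn gen_gen)

lemma simple_refl_eq:
  assumes "n \<ge> 2" "j \<le> n"
  shows "simple_refl n j = restrict (gen n j) (Rn n)"
proof (cases "j = 0")
  case True
  have refl: "reflection n highest_root = restrict (\<lambda>x. x(1 := - x 2, 2 := - x 1)) (Rn n)"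
  proof -
    have "(\<lambda>k. x k - (x 1 + x 2) * highest_root k) = x(1 := - x 2, 2 := - x 1)" for x
      by (auto simp: highest_root_def unit_vec_def)
    then show ?thesis
      by (simp only: reflection_def inner_prod_highest_root[OF assms(1)]
          coroot_highest_root[OF assms(1)])
  qed
  have R: "restrict (\<lambda>x. x(1 := - x 2, 2 := - x 1)) (Rn n) \<in> carrier (Aff n)" (is "?R \<in> _")
    using assms by (intro involution_in_Aff) (auto simp: Rn_def)
  have T: "translation n highest_root \<in> carrier (Aff n)"
    using assms by (simp add: translation_in_Aff highest_root_in_Rn)
  have "(translation n highest_root \<otimes>\<^bsub>Aff n\<^esub> ?R) x = gen n 0 x" if "x \<in> Rn n" for x
  proof -
    have "(\<lambda>k. (x(1 := - x 2, 2 := - x 1)) k + highest_root k) = gen n 0 x"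
      by (auto simp: gen_def highest_root_def unit_vec_def)
    moreover have "x(1 := - x 2, 2 := - x 1) \<in> Rn n"
      using that assms by (auto simp: Rn_def)
    ultimately show ?thesis
      unfolding Aff_mult[OF T R] compose_def
      using that by (simp add: translation_def del: fun_upd_apply)
  qed
  then have "translation n highest_root \<otimes>\<^bsub>Aff n\<^esub> ?R = restrict (gen n 0) (Rn n)"
    using assms T R by (intro Aff_eqI[where n = n] Aff.m_closed gen_in_Aff) auto
  then show ?thesis
    unfolding simple_refl_def refl coroot_highest_root[OF assms(1)] using True by simp
next
  case False
  then show ?thesis
    using assms by (simp add: simple_refl_def reflection_simple_root)
qed

lemma foldr_gen_in_Rn:
  "n \<ge> 2 \<Longrightarrow> set js \<subseteq> {0..n} \<Longrightarrow> x \<in> Rn n \<Longrightarrow> foldr (gen n) js x \<in> Rn n"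
  by (induction js) (auto simp: gen_in_Rn)

text \<open>Both claims come out of one induction: multiplication in \<open>Aff n\<close> unfolds to
  \<open>compose\<close> only for factors known to lie in the carrier.\<close>

lemma word_prod_eq:
  assumes "n \<ge> 2" "set js \<subseteq> {0..n}"
  shows "word_prod n js = restrict (foldr (gen n) js) (Rn n)"
    and "word_prod n js \<in> carrier (Aff n)"
proof -
  have "word_prod n js = restrict (foldr (gen n) js) (Rn n) \<and> word_prod n js \<in> carrier (Aff n)"
    using assms(2)
  proof (induction js)
    case Nil
    have "word_prod n [] = \<one>\<^bsub>Aff n\<^esub>"
      by (simp add: word_prod_def)
    then show ?case
      by (simp add: Aff_one id_def flip: Aff_one)
  next
    case (Cons j js)
    then have IH: "word_prod n js = restrict (foldr (gen n) js) (Rn n)"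
      "word_prod n js \<in> carrier (Aff n)" and j: "j \<le> n"
      by auto
    have step: "word_prod n (j # js) = simple_refl n j \<otimes>\<^bsub>Aff n\<^esub> word_prod n js"
      by (simp add: word_prod_def)
    have s: "simple_refl n j \<in> carrier (Aff n)"
      using assms(1) j by (simp add: simple_refl_eq gen_in_Aff)
    then have "word_prod n (j # js) = compose (Rn n) (simple_refl n j) (word_prod n js)"
      using IH(2) by (simp add: step Aff_mult)
    also have "\<dots> = restrict (foldr (gen n) (j # js)) (Rn n)"
      using Cons.prems assms(1) j
      by (auto simp: IH(1) simple_refl_eq compose_def foldr_gen_in_Rn intro!: restrict_ext)
    finally have "word_prod n (j # js) = restrict (foldr (gen n) (j # js)) (Rn n)" .
    moreover have "word_prod n (j # js) \<in> carrier (Aff n)"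
      using s IH(2) by (simp add: step)
    ultimately show ?case ..
  qed
  then show "word_prod n js = restrict (foldr (gen n) js) (Rn n)"
    and "word_prod n js \<in> carrier (Aff n)"
    by auto
qed

text \<open>The set \<open>S\<close> of letters is kept general: \<open>{1..n}\<close> serves for
  the finite Weyl group and \<open>{0..n}\<close> for the affine one.\<close>

lemma word_prod_in_generate:
  assumes "n \<ge> 2" "set js \<subseteq> S"
  shows "word_prod n js \<in> generate (Aff n) (simple_refl n ` S)"
  using assms(2)
proof (induction js)
  case Nil
  then show ?case
    by (simp add: word_prod_def generate.one)
next
  case (Cons j js)
  then show ?case
    by (simp add: word_prod_def generate.eng generate.incl)
qed

lemma omega_eq:
  assumes "i \<le> n"
  shows "omega n i = restrict (\<lambda>x k. if k \<in> {1..i} then x k + 1 else x k) (Rn n)"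
    and "omega n i \<in> carrier (Aff n)"
proof -
  have v: "(\<lambda>k. \<Sum>j=1..i. unit_vec j k) = (\<lambda>k. if k \<in> {1..i} then 1 else 0)"
    by (auto simp: unit_vec_def fun_eq_iff)
  show "omega n i = restrict (\<lambda>x k. if k \<in> {1..i} then x k + 1 else x k) (Rn n)"
    unfolding omega_def v translation_def by (auto intro!: restrict_ext)
  show "omega n i \<in> carrier (Aff n)"
    unfolding omega_def v by (rule translation_in_Aff) (use assms in \<open>auto simp: Rn_def\<close>)
qed

section \<open>The words of the formulae as coordinate maps\<close>

text \<open>The last letter acts first, so the entry at place \<open>l + 1\<close> is carried left
  one place at a time until it reaches place \<open>k\<close>. Downward induction on
  \<open>k\<close> peels off the letter that acts last.\<close>

lemma foldr_gen_seg:
  assumes "1 \<le> k" "k \<le> l" "l < n"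
  shows "foldr (gen n) (seg k l) x =
    (\<lambda>m. if m = k then x (l + 1) else if k < m \<and> m \<le> l + 1 then x (m - 1) else x m)"
  using assms(2,1)
proof (induction k rule: inc_induct)
  case base
  then show ?case
    using assms by (auto simp: seg_def gen_def fun_eq_iff)
next
  case (step k)
  have "seg k l = k # seg (Suc k) l"
    using step by (simp add: seg_def upt_rec)
  then show ?case
    using step assms(3) by (auto simp: gen_def fun_eq_iff)
qed

text \<open>As for shorter segments, except that the letter \<open>n\<close> acts first and negates
  the entry that is then carried to place \<open>k\<close>.\<close>

lemma foldr_gen_seg_full:
  assumes "1 \<le> k" "k \<le> n"
  shows "foldr (gen n) (seg k n) x =
    (\<lambda>m. if m = k then - x n else if k < m \<and> m \<le> n then x (m - 1) else x m)"
  using assms(2,1)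
proof (induction k rule: inc_induct)
  case base
  then show ?case
    using assms by (auto simp: seg_def gen_def fun_eq_iff)
next
  case (step k)
  have "seg k n = k # seg (Suc k) n"
    using step by (simp add: seg_def upt_rec)
  then show ?case
    using step by (auto simp: gen_def fun_eq_iff)
qed

text \<open>Each segment carries one entry leftwards past the block \<open>x 1, ..., x i\<close>, so
  \<open>t\<close> segments exchange this block with the \<open>t\<close> entries after it. A
  general \<open>t\<close> in place of \<open>n - i\<close> makes the induction possible: one more
  step puts the segment with left end \<open>t + 1\<close> in front.\<close>

lemma foldr_gen_staircase:
  assumes "1 \<le> i" "i + t \<le> n"
  shows "foldr (gen n) (concat (map (\<lambda>k. seg k (k + i - 1)) (rev [1..<Suc t]))) x =
    (\<lambda>m. if 1 \<le> m \<and> m \<le> t then x (i + m) else if t < m \<and> m \<le> t + i then x (m - t) else x m)"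
  using assms(2)
proof (induction t)
  case 0
  then show ?case
    by (auto simp: fun_eq_iff)
next
  case (Suc t)
  define y where "y = foldr (gen n) (concat (map (\<lambda>k. seg k (k + i - 1)) (rev [1..<Suc t]))) x"
  have "foldr (gen n) (concat (map (\<lambda>k. seg k (k + i - 1)) (rev [1..<Suc (Suc t)]))) x
      = foldr (gen n) (seg (Suc t) (Suc t + i - 1)) y"
    by (simp add: y_def)
  also have "\<dots> = (\<lambda>m. if m = Suc t then y (Suc t + i)
      else if Suc t < m \<and> m \<le> Suc t + i then y (m - 1) else y m)"
    using assms(1) Suc.prems by (subst foldr_gen_seg) (auto simp: fun_eq_iff)
  also have "\<dots> = (\<lambda>m. if 1 \<le> m \<and> m \<le> Suc t then x (i + m)
      else if Suc t < m \<and> m \<le> Suc t + i then x (m - Suc t) else x m)"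
  proof
    fix m
    have y: "y = (\<lambda>m. if 1 \<le> m \<and> m \<le> t then x (i + m)
      else if t < m \<and> m \<le> t + i then x (m - t) else x m)"
      using Suc by (simp add: y_def)
    consider "m \<le> t" | "m = Suc t" | "Suc t < m" "m \<le> Suc t + i" | "Suc t + i < m"
      by linarith
    then show "(if m = Suc t then y (Suc t + i)
      else if Suc t < m \<and> m \<le> Suc t + i then y (m - 1) else y m) =
      (if 1 \<le> m \<and> m \<le> Suc t then x (i + m)
      else if Suc t < m \<and> m \<le> Suc t + i then x (m - Suc t) else x m)"
      by cases (use assms(1) in \<open>auto simp: y add.commute\<close>)
  qed
  finally show ?case .
qed

text \<open>The two segments bring \<open>- x n\<close> and \<open>- x (n - 1)\<close> to places 1
  and 2, in this order. Then \<open>gen n 0\<close> swaps them, removes both signs and adds 1 to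
  each.\<close>

lemma foldr_gen_block:
  assumes "n \<ge> 2"
  shows "foldr (gen n) ([0] @ seg 2 n @ seg 1 n) x =
    (\<lambda>m. if 1 \<le> m \<and> m \<le> 2 then 1 + x (n - 2 + m) else if 2 < m \<and> m \<le> n then x (m - 2) else x m)"
proof -
  have "foldr (gen n) ([0] @ seg 2 n @ seg 1 n) x =
    gen n 0 (foldr (gen n) (seg 2 n) (foldr (gen n) (seg 1 n) x))"
    by simp
  also have "\<dots> = (\<lambda>m. if 1 \<le> m \<and> m \<le> 2 then 1 + x (n - 2 + m)
      else if 2 < m \<and> m \<le> n then x (m - 2) else x m)"
  proof
    fix m :: nat
    have m: "m = 0 \<or> m = 1 \<or> m = 2 \<or> 2 < m"
      by linarith
    show "gen n 0 (foldr (gen n) (seg 2 n) (foldr (gen n) (seg 1 n) x)) m =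
      (if 1 \<le> m \<and> m \<le> 2 then 1 + x (n - 2 + m) else if 2 < m \<and> m \<le> n then x (m - 2) else x m)"
    proof -
      have "Suc (n - Suc (Suc 0)) = n - Suc 0" "Suc (Suc (n - Suc (Suc 0))) = n"
        using assms by linarith+
      with m show ?thesis
        using assms by (elim disjE) (auto simp: foldr_gen_seg_full gen_def numeral_2_eq_2)
    qed
  qed
  finally show ?thesis .
qed

text \<open>The bound \<open>2 * t \<le> n\<close> ensures that no entry wraps around twice, so each
  of the last \<open>2 * t\<close> entries gains exactly 1.\<close>

lemma foldr_gen_block_power:
  assumes "n \<ge> 2" "2 * t \<le> n"
  shows "foldr (gen n) (block_power n t) x =
    (\<lambda>m. if 1 \<le> m \<and> m \<le> 2 * t then 1 + x (n - 2 * t + m)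
      else if 2 * t < m \<and> m \<le> n then x (m - 2 * t) else x m)"
  using assms(2)
proof (induction t)
  case 0
  then show ?case
    by (auto simp: block_power_def fun_eq_iff)
next
  case (Suc t)
  define y where "y = foldr (gen n) (block_power n t) x"
  have y: "y = (\<lambda>m. if 1 \<le> m \<and> m \<le> 2 * t then 1 + x (n - 2 * t + m)
      else if 2 * t < m \<and> m \<le> n then x (m - 2 * t) else x m)"
    using Suc by (simp add: y_def)
  have "foldr (gen n) (block_power n (Suc t)) x = foldr (gen n) ([0] @ seg 2 n @ seg 1 n) y"
    by (simp add: y_def block_power_def)
  also have "\<dots> = (\<lambda>m. if 1 \<le> m \<and> m \<le> 2 then 1 + y (n - 2 + m)
      else if 2 < m \<and> m \<le> n then y (m - 2) else y m)"
    using assms(1) by (rule foldr_gen_block)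
  also have "\<dots> = (\<lambda>m. if 1 \<le> m \<and> m \<le> 2 * Suc t then 1 + x (n - 2 * Suc t + m)
      else if 2 * Suc t < m \<and> m \<le> n then x (m - 2 * Suc t) else x m)"
  proof
    fix m
    consider "m = 0" | "1 \<le> m" "m \<le> 2" | "2 < m" "m \<le> 2 * Suc t" | "2 * Suc t < m"
      by linarith
    then show "(if 1 \<le> m \<and> m \<le> 2 then 1 + y (n - 2 + m)
        else if 2 < m \<and> m \<le> n then y (m - 2) else y m) =
      (if 1 \<le> m \<and> m \<le> 2 * Suc t then 1 + x (n - 2 * Suc t + m)
      else if 2 * Suc t < m \<and> m \<le> n then x (m - 2 * Suc t) else x m)"
      by cases (use Suc.prems in \<open>auto simp: y\<close>)
  qed
  finally show ?case .
qed

definition flip :: "nat \<Rightarrow> transf" where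
  "flip n = restrict (\<lambda>x. x(1 := 1 - x 1)) (Rn n)"

lemma flip_in_Aff: "n \<ge> 1 \<Longrightarrow> flip n \<in> carrier (Aff n)"
  unfolding flip_def by (intro involution_in_Aff) (auto simp: Rn_def)

lemma flip_apply: "x \<in> Rn n \<Longrightarrow> flip n x = x(1 := 1 - x 1)"
  by (simp add: flip_def)

lemma flip_flip: "n \<ge> 1 \<Longrightarrow> x \<in> Rn n \<Longrightarrow> flip n (flip n x) = x"
  using flip_apply[OF Aff_into[OF flip_in_Aff]] by (simp add: flip_apply)

lemma set_seg: "set (seg k l) = {k..l}"
  by (auto simp: seg_def)

lemma set_staircase: "1 \<le> i \<Longrightarrow> i \<le> n \<Longrightarrow> set (staircase n i) \<subseteq> {1..n}"
  by (auto simp: staircase_def set_seg)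

lemma set_block_power: "set (block_power n t) \<subseteq> {0..n}"
  by (auto simp: block_power_def set_seg)

text \<open>The staircase moves \<open>x 1, ..., x i\<close> to the last \<open>i\<close> places;
  the \<open>i div 2\<close> blocks then rotate precisely these back to the front and add 1 to
  each.\<close>

lemma foldr_gen_even:
  assumes "n \<ge> 2" "1 \<le> i" "i \<le> n" "even i"
  shows "foldr (gen n) (block_power n (i div 2) @ staircase n i) x =
    (\<lambda>k. if k \<in> {1..i} then x k + 1 else x k)"
proof -
  define z where "z = foldr (gen n) (staircase n i) x"
  have z: "z = (\<lambda>m. if 1 \<le> m \<and> m \<le> n - i then x (i + m)
      else if n - i < m \<and> m \<le> n then x (m - (n - i)) else x m)"
    using foldr_gen_staircase[of i "n - i" n x] assms(2,3)
    by (simp add: z_def staircase_def del: upt_Suc cong: if_cong)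
  have "foldr (gen n) (block_power n (i div 2)) z =
    (\<lambda>m. if 1 \<le> m \<and> m \<le> i then 1 + z (n - i + m)
      else if i < m \<and> m \<le> n then z (m - i) else z m)"
    using foldr_gen_block_power[of n "i div 2" z, unfolded dvd_mult_div_cancel[OF assms(4)]] assms(1,3)
    by simp
  also have "\<dots> = (\<lambda>k. if k \<in> {1..i} then x k + 1 else x k)"
  proof
    fix k
    consider "k = 0" | "1 \<le> k" "k \<le> i" | "i < k" "k \<le> n" | "n < k"
      by linarith
    then show "(if 1 \<le> k \<and> k \<le> i then 1 + z (n - i + k)
      else if i < k \<and> k \<le> n then z (k - i) else z k) = (if k \<in> {1..i} then x k + 1 else x k)"
    proof cases
      case 2
      then have "n - i + k \<le> n"
        using assms(3) by linarith
      with 2 show ?thesis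
        by (simp add: z)
    next
      case 3
      then have "1 \<le> k - i" "k - i \<le> n - i"
        by linarith+
      with 3 show ?thesis
        by (simp add: z)
    next
      case 4
      then have "\<not> k \<le> n - i"
        by linarith
      with 4 show ?thesis
        using assms(3) by (simp add: z)
    qed (simp add: z)
  qed
  finally show ?thesis
    by (simp add: z_def)
qed

text \<open>After the staircase, the blocks wrap only the last \<open>i - 1\<close> places, which
  hold \<open>x 2, ..., x i\<close>. This leaves \<open>x 1\<close> at place \<open>n\<close>, from
  where \<open>seg 1 n\<close> carries it to the front with a sign. That sign is what
  \<open>flip\<close> repairs afterwards.\<close>

lemma foldr_gen_odd:
  assumes "n \<ge> 2" "1 \<le> i" "i \<le> n" "odd i"
  shows "foldr (gen n) (seg 1 n @ block_power n ((i - 1) div 2) @ staircase n i) x =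
    (\<lambda>k. if k = 1 then - x 1 else if k \<in> {1..i} then x k + 1 else x k)"
proof -
  define z where "z = foldr (gen n) (staircase n i) x"
  define w where "w = foldr (gen n) (block_power n ((i - 1) div 2)) z"
  have z: "z = (\<lambda>m. if 1 \<le> m \<and> m \<le> n - i then x (i + m)
      else if n - i < m \<and> m \<le> n then x (m - (n - i)) else x m)"
    using foldr_gen_staircase[of i "n - i" n x] assms(2,3)
    by (simp add: z_def staircase_def del: upt_Suc cong: if_cong)
  have w: "w = (\<lambda>m. if 1 \<le> m \<and> m \<le> i - 1 then 1 + z (n - (i - 1) + m)
      else if i - 1 < m \<and> m \<le> n then z (m - (i - 1)) else z m)"
  proof -
    have "2 * ((i - 1) div 2) = i - 1"
      using assms(4) by simp
    from foldr_gen_block_power[of n "(i - 1) div 2" z, unfolded this] show ?thesis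
      using assms(1,3) by (simp add: w_def)
  qed
  have "foldr (gen n) (seg 1 n) w =
    (\<lambda>m. if m = 1 then - w n else if 1 < m \<and> m \<le> n then w (m - 1) else w m)"
    using foldr_gen_seg_full[of 1 n w] assms by simp
  also have "\<dots> = (\<lambda>k. if k = 1 then - x 1 else if k \<in> {1..i} then x k + 1 else x k)"
  proof
    fix k
    consider "k = 0" | "k = 1" | "1 < k" "k \<le> i" | "i < k" "k \<le> n" | "n < k"
      by linarith
    then show "(if k = 1 then - w n else if 1 < k \<and> k \<le> n then w (k - 1) else w k) =
      (if k = 1 then - x 1 else if k \<in> {1..i} then x k + 1 else x k)"
    proof cases
      case 2
      have "i - 1 < n" "\<not> n \<le> i - 1"
        using assms(2,3) by linarith+
      then have "w n = z (n - (i - 1))"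
        by (simp add: w)
      moreover have "n - (i - 1) = n - i + 1"
        using assms(2,3) by linarith
      moreover have "z (n - i + 1) = x 1"
        using assms(2,3) by (simp add: z)
      ultimately have "w n = x 1"
        by (simp only:)
      then show ?thesis
        using 2 by simp
    next
      case 3
      then have "1 \<le> k - 1" "k - 1 \<le> i - 1"
        by linarith+
      then have "w (k - 1) = 1 + z (n - (i - 1) + (k - 1))"
        by (simp only: w simp_thms if_True)
      moreover have "n - (i - 1) + (k - 1) = n - i + k"
        using 3 assms(3) by linarith
      moreover have "n - i + k \<le> n"
        using 3 assms(3) by linarith
      then have "z (n - i + k) = x k"
        using 3 by (simp add: z)
      ultimately have "w (k - 1) = 1 + x k"
        by (simp only:)
      then show ?thesis
        using 3 assms(3) by simp
    next
      case 4
      then have "\<not> k - 1 \<le> i - 1" "i - 1 < k - 1" "k - 1 \<le> n"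
        using assms(2) by linarith+
      then have "w (k - 1) = z (k - 1 - (i - 1))"
        by (simp only: w simp_thms if_True if_False)
      moreover have "k - 1 - (i - 1) = k - i" "1 \<le> k - i" "k - i \<le> n - i"
        using 4 assms(2) by linarith+
      ultimately have "w (k - 1) = x k"
        using 4 by (simp add: z)
      then show ?thesis
        using 4 assms(2) by simp
    next
      case 5
      then have "\<not> k \<le> n - i" "\<not> k \<le> n" "\<not> k \<le> i - 1" "\<not> k \<le> i" "k \<noteq> 1"
        using assms(1,3) by linarith+
      then show ?thesis
        by (simp only: w z simp_thms if_False atLeastAtMost_iff)
    qed (simp add: w z)
  qed
  finally show ?thesis
    by (simp add: z_def w_def)
qed

section \<open>The formulae in the group, and the identification of \<open>pi1\<close>\<close>

lemma Aff_generate_subset: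
  "n \<ge> 2 \<Longrightarrow> S \<subseteq> {0..n} \<Longrightarrow> generate (Aff n) (simple_refl n ` S) \<subseteq> carrier (Aff n)"
  by (rule Aff.generate_incl) (auto simp: simple_refl_eq gen_in_Aff subset_iff)

text \<open>The simple roots give the consecutive differences of the coordinates, and the induction
  descends from place \<open>n + 1\<close>, where both vectors vanish. It yields the uniqueness of
  \<open>pi1\<close>.\<close>

lemma coordinates_from_simple_roots:
  assumes "x \<in> Rn n" "y \<in> Rn n"
    and "\<And>j. j \<in> {1..n} \<Longrightarrow> affine_simple_root n j x = affine_simple_root n j y"
  shows "x = y"
proof -
  have "x j = y j" if "1 \<le> j" "j \<le> n + 1" for j
    using that(2,1)
  proof (induction j rule: inc_induct)
    case base
    then show ?case
      using assms by (auto simp: Rn_def)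
  next
    case (step j)
    then have "x j - x (j + 1) = y j - y (j + 1)"
      using assms(3)[of j] assms(1,2)
      by (auto simp: affine_simple_root_def inner_prod_simple_root)
    then show ?case
      using step by auto
  qed
  moreover have "x j = y j" if "\<not> (1 \<le> j \<and> j \<le> n + 1)" for j
    using that assms(1,2) by (auto simp: Rn_def)
  ultimately show ?thesis
    by blast
qed

lemma affine_simple_root_flip:
  assumes "n \<ge> 2" "x \<in> Rn n"
  shows "affine_simple_root n 0 (flip n x) = affine_simple_root n 1 x"
    and "affine_simple_root n 1 (flip n x) = affine_simple_root n 0 x"
    and "j \<in> {2..n} \<Longrightarrow> affine_simple_root n j (flip n x) = affine_simple_root n j x"
proof -
  have f: "flip n x \<in> Rn n" "flip n x = x(1 := 1 - x 1)"
    using assms by (auto simp: flip_def Rn_def)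
  show "affine_simple_root n 0 (flip n x) = affine_simple_root n 1 x"
    and "affine_simple_root n 1 (flip n x) = affine_simple_root n 0 x"
    and "j \<in> {2..n} \<Longrightarrow> affine_simple_root n j (flip n x) = affine_simple_root n j x"
    using assms f
    by (auto simp: affine_simple_root_def inner_prod_simple_root inner_prod_highest_root
        numeral_2_eq_2)
qed

lemma inv_flip: "n \<ge> 1 \<Longrightarrow> inv\<^bsub>Aff n\<^esub> (flip n) = flip n"
proof -
  assume n: "n \<ge> 1"
  have "flip n \<otimes>\<^bsub>Aff n\<^esub> flip n = \<one>\<^bsub>Aff n\<^esub>"
    using n by (auto simp: Aff_mult flip_in_Aff Aff_one compose_def flip_flip intro!: restrict_ext)
  then show ?thesis
    using n by (simp add: Aff.inv_equality flip_in_Aff)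
qed

lemma omega_odd_eq_flip_mult:
  assumes "n \<ge> 2" "1 \<le> i" "i \<le> n" "odd i"
  shows "omega n i = flip n \<otimes>\<^bsub>Aff n\<^esub>
    word_prod n (seg 1 n @ block_power n ((i - 1) div 2) @ staircase n i)"
    (is "_ = _ \<otimes>\<^bsub>_\<^esub> word_prod n ?js")
proof -
  have js: "set ?js \<subseteq> {0..n}"
    using assms set_staircase[of i n] set_block_power[of n "(i - 1) div 2"] by (auto simp: set_seg)
  have W: "word_prod n ?js \<in> carrier (Aff n)" and F: "flip n \<in> carrier (Aff n)"
    using assms(1) word_prod_eq(2)[OF assms(1) js] by (auto intro: flip_in_Aff)
  show ?thesis
  proof (rule Aff_eqI[where n = n])
    fix x assume x: "x \<in> Rn n"
    have "(flip n \<otimes>\<^bsub>Aff n\<^esub> word_prod n ?js) x = flip n (foldr (gen n) ?js x)"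
      unfolding Aff_mult[OF F W] compose_def
      unfolding word_prod_eq(1)[OF assms(1) js] using x by simp
    also have "\<dots> = (foldr (gen n) ?js x)(1 := 1 - foldr (gen n) ?js x 1)"
      by (rule flip_apply[OF foldr_gen_in_Rn[OF assms(1) js x]])
    \<comment> \<open>At place 1 the word leaves \<open>- x 1\<close>, and
      \<open>1 - (- x 1)\<close> is the required \<open>x 1 + 1\<close>.\<close>
    also have "\<dots> = omega n i x"
      unfolding foldr_gen_odd[OF assms] using assms x by (auto simp: omega_eq(1))
    finally show "omega n i x = (flip n \<otimes>\<^bsub>Aff n\<^esub> word_prod n ?js) x" ..
  qed (use F W assms omega_eq(2) in auto)
qed

lemma omega_even_eq_word_prod:
  assumes "n \<ge> 2" "1 \<le> i" "i \<le> n" "even i"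
  shows "omega n i = word_prod n (block_power n (i div 2) @ staircase n i)"
    (is "_ = word_prod n ?js")
proof -
  have "set ?js \<subseteq> {0..n}"
    using assms set_staircase[of i n] set_block_power[of n "i div 2"] by (auto simp: set_seg)
  show ?thesis
    unfolding word_prod_eq(1)[OF assms(1) \<open>set ?js \<subseteq> {0..n}\<close>] omega_eq(1)[OF assms(3)]
      foldr_gen_even[OF assms] ..
qed

text \<open>For \<open>i = 1\<close> the word of the odd formula contains no letter 0, so the
  formula itself writes \<open>flip n\<close> as \<open>omega n 1\<close> times an element of the
  finite Weyl group.\<close>

lemma flip_in_ext_weyl:
  assumes "n \<ge> 2"
  shows "flip n \<in> carrier (ext_weyl n)"
proof -
  let ?js = "seg 1 n @ block_power n 0 @ staircase n 1"
  let ?W = "word_prod n ?js"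
  have js: "set ?js \<subseteq> {1..n}"
    using assms set_staircase[of 1 n] by (auto simp: set_seg block_power_def)
  then have js0: "set ?js \<subseteq> {0..n}"
    by auto
  have W: "?W \<in> carrier (Aff n)" "?W \<in> fin_weyl n"
    using word_prod_eq(2)[OF assms js0] word_prod_in_generate[OF assms js]
    by (simp_all add: fin_weyl_def)
  have "omega n 1 \<otimes>\<^bsub>Aff n\<^esub> inv\<^bsub>Aff n\<^esub> ?W = flip n"
    using omega_odd_eq_flip_mult[of n 1] assms W(1) flip_in_Aff[of n]
    by (simp add: Aff.m_assoc)
  moreover have "omega n 1 \<in> transl_lattice n"
    using assms by (auto simp: transl_lattice_def intro!: generate.incl)
  moreover have "inv\<^bsub>Aff n\<^esub> ?W \<in> fin_weyl n"
    using W(2) unfolding fin_weyl_def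
    by (rule Aff.generate_m_inv_closed[rotated])
      (use assms in \<open>auto simp: simple_refl_eq gen_in_Aff\<close>)
  ultimately show ?thesis
    by (force simp: ext_weyl_def set_mult_def)
qed

lemma ext_weyl_subset: "n \<ge> 2 \<Longrightarrow> carrier (ext_weyl n) \<subseteq> carrier (Aff n)"
proof -
  assume n: "n \<ge> 2"
  have "transl_lattice n \<subseteq> carrier (Aff n)"
    unfolding transl_lattice_def by (rule Aff.generate_incl) (use omega_eq(2) in auto)
  moreover have "fin_weyl n \<subseteq> carrier (Aff n)"
    unfolding fin_weyl_def using n by (rule Aff_generate_subset) auto
  ultimately show ?thesis
    by (simp add: ext_weyl_def Aff.set_mult_closed)
qed

text \<open>The definite description demands existence and uniqueness. For uniqueness, the
  prescribed action fixes the values of the simple roots at each image under the inverse of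
  \<open>g\<close>, hence the inverse and \<open>g\<close>.\<close>

lemma pi1_eq_flip:
  assumes "n \<ge> 2"
  shows "pi1 n = flip n"
  unfolding pi1_def
proof (rule the_equality)
  show "flip n \<in> carrier (ext_weyl n)
      \<and> root_action n (flip n) (affine_simple_root n 0) = affine_simple_root n 1
      \<and> root_action n (flip n) (affine_simple_root n 1) = affine_simple_root n 0
      \<and> (\<forall>j\<in>{2..n}. root_action n (flip n) (affine_simple_root n j) = affine_simple_root n j)"
    using assms affine_simple_root_flip[OF assms] flip_in_ext_weyl[OF assms]
    by (auto simp: root_action_def inv_flip affine_simple_root_def fun_eq_iff simp del: One_nat_def)
next
  fix g
  assume g: "g \<in> carrier (ext_weyl n)
      \<and> root_action n g (affine_simple_root n 0) = affine_simple_root n 1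
      \<and> root_action n g (affine_simple_root n 1) = affine_simple_root n 0
      \<and> (\<forall>j\<in>{2..n}. root_action n g (affine_simple_root n j) = affine_simple_root n j)"
  then have gA: "g \<in> carrier (Aff n)"
    using ext_weyl_subset[OF assms] by auto
  have "(inv\<^bsub>Aff n\<^esub> g) x = flip n x" if x: "x \<in> Rn n" for x
  proof (rule coordinates_from_simple_roots)
    show "(inv\<^bsub>Aff n\<^esub> g) x \<in> Rn n" "flip n x \<in> Rn n"
      using Aff_into[OF Aff.inv_closed[OF gA] x] Aff_into[OF flip_in_Aff x] assms by auto
    fix j assume "j \<in> {1..n}"
    then consider "j = 1" | "j \<in> {2..n}"
      by force
    then show "affine_simple_root n j ((inv\<^bsub>Aff n\<^esub> g) x) = affine_simple_root n j (flip n x)"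
    proof cases
      case 1
      have "root_action n g (affine_simple_root n 1) x = affine_simple_root n 0 x"
        using g by simp
      then show ?thesis
        using x 1 affine_simple_root_flip(2)[OF assms x] by (simp add: root_action_def)
    next
      case 2
      then have "root_action n g (affine_simple_root n j) x = affine_simple_root n j x"
        using g by simp
      then show ?thesis
        using x affine_simple_root_flip(3)[OF assms x 2] by (simp add: root_action_def)
    qed
  qed
  then have "inv\<^bsub>Aff n\<^esub> g = flip n"
    using gA assms by (intro Aff_eqI[where n = n]) (auto simp: flip_in_Aff)
  then have "g = inv\<^bsub>Aff n\<^esub> (flip n)"
    using gA by (metis Aff.inv_inv)
  then show "g = flip n"
    using assms by (simp add: inv_flip)
qed

section \<open>The coroot lattice and the decomposition of the extended group\<close>

text \<open>This is the coroot lattice of type B, the orbit of 0 under the affine Weyl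
  group.\<close>

definition even_lattice :: "nat \<Rightarrow> (nat \<Rightarrow> real) set" where
  "even_lattice n = {x \<in> Rn n. (\<forall>k. x k \<in> \<int>) \<and> (\<Sum>k=1..n. x k) / 2 \<in> \<int>}"

lemma sum_fun_upd_real:
  fixes x :: "nat \<Rightarrow> real"
  assumes "finite A" "j \<in> A"
  shows "sum (x(j := v)) A = sum x A + v - x j"
proof -
  have "sum (x(j := v)) (A - {j}) = sum x (A - {j})"
    by (rule sum.cong) auto
  then show ?thesis
    using assms by (simp add: sum.remove)
qed

text \<open>Transpositions keep the coordinate sum, the letter \<open>n\<close> changes it by
  \<open>- 2 * x n\<close>, and the letter 0 by \<open>2 - 2 * x 1 - 2 * x 2\<close>; on integral
  vectors all of these are even.\<close>

lemma gen_even_lattice: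
  assumes "n \<ge> 2" "j \<le> n" "x \<in> even_lattice n"
  shows "gen n j x \<in> even_lattice n"
proof -
  let ?S = "\<lambda>x::nat \<Rightarrow> real. sum x {1..n}"
  have x: "x \<in> Rn n" "\<And>k. x k \<in> \<int>" "?S x / 2 \<in> \<int>"
    using assms(3) by (auto simp: even_lattice_def)
  consider "j = 0" | "1 \<le> j" "j < n" | "j = n" "j \<noteq> 0"
    using assms(2) by linarith
  then have "?S (gen n j x) / 2 \<in> \<int>"
  proof cases
    case 1
    then have "?S (gen n j x) / 2 = ?S x / 2 + 1 - x 1 - x 2"
      using assms(1) by (simp add: gen_def sum_fun_upd_real field_simps fun_upd_other del: fun_upd_apply)
    then show ?thesis
      using x by (simp only:) (intro Ints_add Ints_diff Ints_1)
  next
    case 2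
    then have "?S (gen n j x) = ?S x"
      by (simp add: gen_def sum_fun_upd_real fun_upd_other del: fun_upd_apply)
    then show ?thesis
      using x by simp
  next
    case 3
    then have "?S (gen n j x) / 2 = ?S x / 2 - x n"
      by (simp add: gen_def sum_fun_upd_real field_simps fun_upd_other del: fun_upd_apply)
    then show ?thesis
      using x by (simp only:) (intro Ints_diff)
  qed
  moreover have "gen n j x k \<in> \<int>" for k
    using x(2) by (auto simp: gen_def)
  ultimately show ?thesis
    using gen_in_Rn[OF assms(1,2) x(1)] by (simp add: even_lattice_def)
qed

lemma aff_weyl_even_lattice:
  assumes "n \<ge> 2" "w \<in> aff_weyl n" "x \<in> even_lattice n"
  shows "w x \<in> even_lattice n"
  using assms(2,3) unfolding aff_weyl_def
proof (induction arbitrary: x rule: generate.induct)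
  case one
  then show ?case
    by (simp add: Aff_one even_lattice_def)
next
  case (incl h)
  then show ?case
    using assms(1) by (auto simp: simple_refl_eq gen_even_lattice)
      (auto simp: even_lattice_def)
next
  case (inv h)
  then obtain j where j: "j \<le> n" "h = restrict (gen n j) (Rn n)"
    using assms(1) by (auto simp: simple_refl_eq)
  have "h \<otimes>\<^bsub>Aff n\<^esub> h = \<one>\<^bsub>Aff n\<^esub>"
    using j assms(1) by (auto simp: Aff_mult gen_in_Aff Aff_one compose_def gen_in_Rn gen_gen
        intro!: restrict_ext)
  then have "inv\<^bsub>Aff n\<^esub> h = h"
    using j assms(1) by (simp add: Aff.inv_equality gen_in_Aff)
  then show ?case
    using assms(1) inv.prems j gen_even_lattice[of n j x] by (auto simp: even_lattice_def)
next
  case (eng h1 h2)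
  have "h1 \<in> carrier (Aff n)" "h2 \<in> carrier (Aff n)"
    using eng.hyps Aff_generate_subset[OF assms(1), of "{0..n}"] by auto
  moreover have "x \<in> Rn n"
    using eng.prems by (simp add: even_lattice_def)
  ultimately show ?case
    using eng.IH eng.prems by (simp add: Aff_mult compose_def)
qed

lemma zero_even_lattice: "(\<lambda>_. 0) \<in> even_lattice n"
  by (simp add: even_lattice_def Rn_def)

lemma flip_not_even_lattice:
  assumes "n \<ge> 2" "x \<in> even_lattice n"
  shows "flip n x \<notin> even_lattice n"
proof
  assume "flip n x \<in> even_lattice n"
  moreover have "x \<in> Rn n" "x 1 \<in> \<int>" "sum x {1..n} / 2 \<in> \<int>"
    using assms by (auto simp: even_lattice_def)
  \<comment> \<open>A combination of three integers, the first being half the coordinate sum of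
    \<open>flip n x\<close>; its value is 1/2.\<close>
  ultimately have "(sum x {1..n} + 1 - 2 * x 1) / 2 - sum x {1..n} / 2 + x 1 \<in> \<int>"
    using assms(1)
    by (intro Ints_add Ints_diff) (simp_all add: even_lattice_def flip_def sum_fun_upd_real del: fun_upd_apply)
  then have "(1/2::real) \<in> \<int>"
    by (simp add: field_simps)
  then obtain m :: int where "1/2 = (of_int m :: real)"
    by (rule Ints_cases)
  then have "of_int (2 * m) = (of_int 1 :: real)"
    by simp
  then have "2 * m = 1"
    by (simp only: of_int_eq_iff)
  then show False
    by presburger
qed

lemma word_prod_in_aff_weyl:
  "n \<ge> 2 \<Longrightarrow> set js \<subseteq> {0..n} \<Longrightarrow> word_prod n js \<in> aff_weyl n"
  unfolding aff_weyl_def by (rule word_prod_in_generate)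

lemma flip_mult_aff_weyl_neq:
  assumes "n \<ge> 2" "w \<in> aff_weyl n" "w' \<in> aff_weyl n"
  shows "flip n \<otimes>\<^bsub>Aff n\<^esub> w \<noteq> w'"
proof
  assume "flip n \<otimes>\<^bsub>Aff n\<^esub> w = w'"
  moreover have "w \<in> carrier (Aff n)"
    using assms Aff_generate_subset[of n "{0..n}"] by (auto simp: aff_weyl_def)
  moreover have "(\<lambda>_. 0) \<in> Rn n"
    by (simp add: Rn_def)
  ultimately have "w' (\<lambda>_. 0) = flip n (w (\<lambda>_. 0))"
    using assms(1) by (auto simp: Aff_mult flip_in_Aff compose_def)
  then show False
    using assms by (metis aff_weyl_even_lattice flip_not_even_lattice zero_even_lattice)
qed

text \<open>This evaluates the definite description in \<open>ext_length\<close>. Two decompositions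
  with different factors in \<open>Lambda n\<close> would put a product of \<open>flip n\<close>
  with an element of \<open>aff_weyl n\<close> back into \<open>aff_weyl n\<close>.\<close>

lemma ext_length_Lambda_mult:
  assumes "n \<ge> 2" "u \<in> Lambda n" "w \<in> aff_weyl n"
  shows "ext_length n (u \<otimes>\<^bsub>ext_weyl n\<^esub> w) = coxeter_length n w"
proof -
  have W: "aff_weyl n \<subseteq> carrier (Aff n)"
    using assms(1) by (auto simp: aff_weyl_def dest!: subsetD[OF Aff_generate_subset, rotated 2])
  have L: "Lambda n = {\<one>\<^bsub>Aff n\<^esub>, flip n}"
    using assms(1) by (simp add: Lambda_def pi1_eq_flip)
  have F: "flip n \<in> carrier (Aff n)"
    using assms(1) by (simp add: flip_in_Aff)
  have "w' = w" if w': "w' \<in> aff_weyl n" "u' \<in> Lambda n"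
    and eq: "u \<otimes>\<^bsub>Aff n\<^esub> w = u' \<otimes>\<^bsub>Aff n\<^esub> w'" for u' w'
  proof (cases "u = u'")
    case True
    then show ?thesis
      using eq w' assms W F L by (auto simp: subset_iff)
  next
    case False
    then have "flip n \<otimes>\<^bsub>Aff n\<^esub> w = w' \<or> flip n \<otimes>\<^bsub>Aff n\<^esub> w' = w"
      using eq w' assms W L by (auto simp: subset_iff)
    then show ?thesis
      using flip_mult_aff_weyl_neq assms w' by metis
  qed
  then have "(THE w'. w' \<in> aff_weyl n \<and> (\<exists>u'\<in>Lambda n. u \<otimes>\<^bsub>ext_weyl n\<^esub> w = u' \<otimes>\<^bsub>ext_weyl n\<^esub> w')) = w"
    using assms by (intro the_equality) auto
  then show ?thesis
    by (simp add: ext_length_def)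
qed

section \<open>A pseudometric counting separating hyperplanes, and its invariance\<close>

text \<open>Floor plus ceiling. Unlike the floor alone, this function is odd at every real number,
  integers included, so sign changes need no exceptional cases.\<close>

definition wall_index :: "real \<Rightarrow> int" where
  "wall_index t = \<lfloor>t\<rfloor> - \<lfloor>- t\<rfloor>"

lemma wall_index_minus: "wall_index (- t) = - wall_index t"
  by (simp add: wall_index_def)

lemma wall_index_add_int: "wall_index (t + of_int m) = wall_index t + 2 * m"
proof -
  have "\<lfloor>- (t + of_int m)\<rfloor> = \<lfloor>- t\<rfloor> - m"
    using floor_diff_of_int[of "- t" m] by simp
  then show ?thesis
    by (simp add: wall_index_def)
qed

lemma wall_index_unit: "0 < t \<Longrightarrow> t < 1 \<Longrightarrow> wall_index t = 1"
proof -
  assume "0 < t" "t < 1"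
  then have "\<lfloor>t\<rfloor> = 0" "\<lfloor>- t\<rfloor> = - 1"
    by (simp_all add: floor_eq_iff)
  then show ?thesis
    by (simp add: wall_index_def)
qed

abbreviation wall_diff :: "real \<Rightarrow> real \<Rightarrow> int" where
  "wall_diff s t \<equiv> \<bar>wall_index s - wall_index t\<bar>"

lemma wall_diff_isometry:
  assumes "e = 1 \<or> e = - 1"
  shows "wall_diff (e * s + of_int m) (e * t + of_int m) = wall_diff s t"
  using assms by (auto simp: wall_index_add_int wall_index_minus)

text \<open>Changing signs of the two coordinates permutes the difference and the sum up to sign.
  The two terms may be exchanged, so it is their total that is invariant.\<close>

lemma wall_diff_signs:
  fixes e f :: real
  assumes "e = 1 \<or> e = - 1" "f = 1 \<or> f = - 1"
  shows "wall_diff (e * a - f * b) (e * c - f * d) + wall_diff (e * a + f * b) (e * c + f * d)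
    = wall_diff (a - b) (c - d) + wall_diff (a + b) (c + d)"
proof -
  have minus: "wall_index (s - t) = - wall_index (t - s)" "wall_index (- s - t) = - wall_index (s + t)"
    for s t
    using wall_index_minus[of "t - s"] wall_index_minus[of "s + t"] by simp_all
  from assms show ?thesis
    by (elim disjE) (simp_all add: minus(2) minus(1)[of b a] minus(1)[of d c] abs_minus_commute)
qed

text \<open>Ordered pairs, so that a permutation of the coordinates acts by \<open>map_prod\<close>
  without any reordering.\<close>

definition index_pairs :: "nat \<Rightarrow> (nat \<times> nat) set" where
  "index_pairs n = {(j, k). j \<in> {1..n} \<and> k \<in> {1..n} \<and> j \<noteq> k}"

lemma finite_index_pairs: "finite (index_pairs n)"
  by (rule finite_subset[of _ "{1..n} \<times> {1..n}"]) (auto simp: index_pairs_def)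

text \<open>
  Off the hyperplanes, \<open>wall_index s - wall_index t\<close> is twice the number of integers between
  \<open>s\<close> and \<open>t\<close>, and the ordered pairs count each root \<open>e\<^sub>j \<plusminus> e\<^sub>k\<close> twice. So the following is
  four times the number of affine root hyperplanes that separate \<open>x\<close> from \<open>y\<close>.
\<close>

definition pair_dist :: "(nat \<Rightarrow> real) \<Rightarrow> (nat \<Rightarrow> real) \<Rightarrow> nat \<times> nat \<Rightarrow> int" where
  "pair_dist x y = (\<lambda>(j, k). wall_diff (x j - x k) (y j - y k) + wall_diff (x j + x k) (y j + y k))"

definition wall_dist :: "nat \<Rightarrow> (nat \<Rightarrow> real) \<Rightarrow> (nat \<Rightarrow> real) \<Rightarrow> int" where
  "wall_dist n x y = 2 * (\<Sum>k=1..n. wall_diff (x k) (y k)) + sum (pair_dist x y) (index_pairs n)"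

lemma wall_dist_triangle: "wall_dist n x z \<le> wall_dist n x y + wall_dist n y z"
proof -
  have "(\<Sum>k=1..n. wall_diff (x k) (z k))
      \<le> (\<Sum>k=1..n. wall_diff (x k) (y k)) + (\<Sum>k=1..n. wall_diff (y k) (z k))"
    unfolding sum.distrib[symmetric] by (rule sum_mono) linarith
  moreover have "sum (pair_dist x z) (index_pairs n)
      \<le> sum (pair_dist x y) (index_pairs n) + sum (pair_dist y z) (index_pairs n)"
    unfolding sum.distrib[symmetric]
    by (rule sum_mono) (auto simp: pair_dist_def)
  ultimately show ?thesis
    by (simp add: wall_dist_def)
qed

text \<open>An integral shift changes the wall indices of both points by the same amount, signs are
  absorbed by \<open>wall_diff_signs\<close>, and the permutation only reindexes the two
  sums.\<close>

lemma wall_dist_isometry: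
  assumes \<sigma>: "bij_betw \<sigma> {1..n} {1..n}"
    and e: "\<And>k. e k = 1 \<or> e k = (- 1 :: real)"
  shows "wall_dist n (\<lambda>k. e k * x (\<sigma> k) + of_int (c k)) (\<lambda>k. e k * y (\<sigma> k) + of_int (c k))
    = wall_dist n x y" (is "wall_dist n ?x ?y = _")
proof -
  have "(\<Sum>k=1..n. wall_diff (?x k) (?y k)) = (\<Sum>k=1..n. wall_diff (x (\<sigma> k)) (y (\<sigma> k)))"
    using e by (simp add: wall_diff_isometry)
  also have "\<dots> = (\<Sum>k=1..n. wall_diff (x k) (y k))"
    by (rule sum.reindex_bij_betw[OF \<sigma>])
  finally have single: "(\<Sum>k=1..n. wall_diff (?x k) (?y k)) = (\<Sum>k=1..n. wall_diff (x k) (y k))" .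
  have bij: "bij_betw (map_prod \<sigma> \<sigma>) (index_pairs n) (index_pairs n)"
  proof -
    have inj: "inj_on \<sigma> {1..n}"
      using \<sigma> by (rule bij_betw_imp_inj_on)
    have "inj_on (map_prod \<sigma> \<sigma>) (index_pairs n)"
      by (rule inj_on_subset[OF map_prod_inj_on[OF inj inj]]) (auto simp: index_pairs_def)
    moreover have "map_prod \<sigma> \<sigma> ` index_pairs n \<subseteq> index_pairs n"
    proof (rule image_subsetI)
      fix q assume "q \<in> index_pairs n"
      moreover obtain a b where q: "q = (a, b)"
        by (cases q)
      ultimately have "\<sigma> a \<in> {1..n}" "\<sigma> b \<in> {1..n}" "\<sigma> a \<noteq> \<sigma> b"
        using inj_onD[OF inj, of a b] bij_betwE[OF \<sigma>] by (auto simp: index_pairs_def)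
      then show "map_prod \<sigma> \<sigma> q \<in> index_pairs n"
        by (simp add: index_pairs_def q)
    qed
    ultimately show ?thesis
      by (simp add: bij_betw_def endo_inj_surj finite_index_pairs)
  qed
  have "pair_dist ?x ?y (j, k) = pair_dist x y (\<sigma> j, \<sigma> k)" for j k
  proof -
    have *: "wall_diff (s + s' + (of_int a + of_int b)) (t + t' + (of_int a + of_int b))
        = wall_diff (s + s') (t + t')" for s s' t t' a b
      using wall_index_add_int[of "s + s'" "a + b"] wall_index_add_int[of "t + t'" "a + b"] by simp
    have "wall_diff (?x j - ?x k) (?y j - ?y k)
        = wall_diff (e j * x (\<sigma> j) - e k * x (\<sigma> k)) (e j * y (\<sigma> j) - e k * y (\<sigma> k))"
      using *[of "e j * x (\<sigma> j)" "- e k * x (\<sigma> k)" "c j" "- c k" "e j * y (\<sigma> j)" "- e k * y (\<sigma> k)"]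
      by (simp add: algebra_simps)
    moreover have "wall_diff (?x j + ?x k) (?y j + ?y k)
        = wall_diff (e j * x (\<sigma> j) + e k * x (\<sigma> k)) (e j * y (\<sigma> j) + e k * y (\<sigma> k))"
      using *[of "e j * x (\<sigma> j)" "e k * x (\<sigma> k)" "c j" "c k" "e j * y (\<sigma> j)" "e k * y (\<sigma> k)"]
      by (simp add: algebra_simps)
    ultimately show ?thesis
      using wall_diff_signs[OF e e, of j "x (\<sigma> j)" k "x (\<sigma> k)" "y (\<sigma> j)" "y (\<sigma> k)"]
      by (simp only: pair_dist_def prod.case)
  qed
  then have "sum (pair_dist ?x ?y) (index_pairs n) = (\<Sum>q\<in>index_pairs n. pair_dist x y (map_prod \<sigma> \<sigma> q))"
    by (intro sum.cong) auto
  also have "\<dots> = sum (pair_dist x y) (index_pairs n)"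
    by (rule sum.reindex_bij_betw[OF bij])
  finally show ?thesis
    by (simp only: wall_dist_def single)
qed

lemma pair_dist_commute: "pair_dist x y (a, b) = pair_dist x y (b, a)"
  using wall_index_minus[of "x b - x a"] wall_index_minus[of "y b - y a"]
  by (simp add: pair_dist_def add.commute)

text \<open>Made for maps that cross at most one wall, belonging to a short root at \<open>r\<close>
  or to a pair \<open>(c, d)\<close>. Each contributes 4: the short one through the factor 2, the
  pair through its two orders. Index 0 lies outside the range, so \<open>r = 0\<close> or
  \<open>(c, d) = (0, 0)\<close> encodes the absence of such a root.\<close>

lemma wall_dist_le:
  assumes single: "\<And>k. k \<in> {1..n} \<Longrightarrow> wall_diff (x k) (y k) \<le> (if k = r then 2 else 0)"
    and pair: "\<And>a b. 1 \<le> a \<Longrightarrow> a < b \<Longrightarrow> b \<le> n \<Longrightarrow>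
      pair_dist x y (a, b) \<le> (if (a, b) = (c, d) then 2 else 0)"
  shows "wall_dist n x y \<le> (if r \<in> {1..n} then 4 else 0) + (if (c, d) \<in> index_pairs n then 4 else 0)"
proof -
  have "(\<Sum>k=1..n. wall_diff (x k) (y k)) \<le> (\<Sum>k=1..n. if k = r then 2 else 0)"
    by (rule sum_mono) (rule single)
  also have "\<dots> = (if r \<in> {1..n} then 2 else 0)"
    by simp
  finally have S: "(\<Sum>k=1..n. wall_diff (x k) (y k)) \<le> (if r \<in> {1..n} then 2 else 0)" .
  have "sum (pair_dist x y) (index_pairs n)
      \<le> (\<Sum>q\<in>index_pairs n. (if q = (c, d) then 2 else 0) + (if q = (d, c) then 2 else 0))"
  proof (rule sum_mono)
    fix q assume "q \<in> index_pairs n"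
    then obtain a b where q: "q = (a, b)" "a \<in> {1..n}" "b \<in> {1..n}" "a \<noteq> b"
      by (auto simp: index_pairs_def)
    show "pair_dist x y q \<le> (if q = (c, d) then 2 else 0) + (if q = (d, c) then 2 else 0)"
    proof (cases "a < b")
      case True
      then show ?thesis
        using pair[of a b] q by (auto split: if_splits)
    next
      case False
      then show ?thesis
        using pair[of b a] q pair_dist_commute[of x y a b] by (auto split: if_splits)
    qed
  qed
  also have "\<dots> = (if (c, d) \<in> index_pairs n then 4 else 0)"
    by (simp add: sum.distrib finite_index_pairs) (auto simp: index_pairs_def)
  finally show ?thesis
    using S unfolding wall_dist_def
    by (cases "r \<in> {1..n}"; cases "(c, d) \<in> index_pairs n"; simp del: atLeastAtMost_iff)
qed

lemma gen_signed_permutation: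
  assumes "n \<ge> 2" "j \<le> n"
  obtains \<sigma> :: "nat \<Rightarrow> nat" and e :: "nat \<Rightarrow> real" and c :: "nat \<Rightarrow> int"
  where "bij_betw \<sigma> {1..n} {1..n}" "\<And>k. e k = 1 \<or> e k = - 1"
    "\<And>x. gen n j x = (\<lambda>k. e k * x (\<sigma> k) + of_int (c k))"
proof -
  consider "j = 0" | "1 \<le> j" "j < n" | "j = n" "j \<noteq> 0"
    using assms(2) by linarith
  then show thesis
  proof cases
    case 1
    show thesis
      by (rule that[of "Transposition.transpose 1 2" "\<lambda>k. if k \<in> {1, 2} then - 1 else 1"
            "\<lambda>k. if k \<in> {1, 2} then 1 else 0"])
        (use 1 assms in \<open>auto simp: gen_def fun_eq_iff Transposition.transpose_def\<close>)
  next
    case 2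
    show thesis
      by (rule that[of "Transposition.transpose j (j + 1)" "\<lambda>_. 1" "\<lambda>_. 0"])
        (use 2 in \<open>auto simp: gen_def fun_eq_iff Transposition.transpose_def\<close>)
  next
    case 3
    show thesis
      by (rule that[of id "\<lambda>k. if k = n then - 1 else 1" "\<lambda>_. 0"])
        (use 3 in \<open>auto simp: gen_def fun_eq_iff\<close>)
  qed
qed

lemma wall_dist_gen:
  assumes "n \<ge> 2" "j \<le> n"
  shows "wall_dist n (gen n j x) (gen n j y) = wall_dist n x y"
proof -
  obtain \<sigma> :: "nat \<Rightarrow> nat" and e :: "nat \<Rightarrow> real" and c :: "nat \<Rightarrow> int"
    where "bij_betw \<sigma> {1..n} {1..n}" "\<And>k. e k = 1 \<or> e k = - 1"
      and gen: "\<And>x. gen n j x = (\<lambda>k. e k * x (\<sigma> k) + of_int (c k))"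
    using gen_signed_permutation[OF assms] by metis
  then show ?thesis
    unfolding gen by (intro wall_dist_isometry)
qed

lemma wall_dist_flip:
  assumes "x \<in> Rn n" "y \<in> Rn n"
  shows "wall_dist n (flip n x) (flip n y) = wall_dist n x y"
proof -
  have "flip n z = (\<lambda>k. (if k = 1 then - 1 else 1) * z (id k) + of_int (if k = 1 then 1 else 0))"
    if "z \<in> Rn n" for z
    using that by (auto simp: flip_apply)
  then show ?thesis
    using assms wall_dist_isometry[of id n "\<lambda>k. if k = 1 then - 1 else 1" x "\<lambda>k. if k = 1 then 1 else 0" y]
    by simp
qed

section \<open>Moving a point of the fundamental alcove\<close>

text \<open>The coordinates decrease strictly inside the interval from 0 to 1/2. Hence every
  positive root takes a value strictly between 0 and 1 here, where \<open>wall_index\<close> is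
  1.\<close>

definition alcove_point :: "nat \<Rightarrow> nat \<Rightarrow> real" where
  "alcove_point n k = (if k \<in> {1..n} then (real n + 1 - real k) / (2 * real n + 2) else 0)"

lemma alcove_point_in_Rn: "alcove_point n \<in> Rn n"
  by (simp add: Rn_def alcove_point_def)

lemma alcove_point_bounds:
  assumes "k \<in> {1..n}"
  shows "0 < alcove_point n k" "alcove_point n k < 1 / 2"
  using assms by (auto simp: alcove_point_def field_simps)

lemma alcove_point_less: "1 \<le> a \<Longrightarrow> a < b \<Longrightarrow> b \<le> n \<Longrightarrow> alcove_point n b < alcove_point n a"
  by (simp add: alcove_point_def divide_strict_right_mono)

text \<open>After the reflection all positive roots but one still take values between 0 and 1. The
  exception is the highest root for \<open>j = 0\<close> and the simple root of index
  \<open>j\<close> otherwise.\<close>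

lemma wall_dist_alcove_gen:
  assumes "n \<ge> 2" "j \<le> n"
  shows "wall_dist n (alcove_point n) (gen n j (alcove_point n)) \<le> 4"
proof -
  define p where "p = alcove_point n"
  note bounds = alcove_point_bounds[of _ n, folded p_def]
  note less = alcove_point_less[of _ _ n, folded p_def]
  consider "j = 0" | "1 \<le> j" "j < n" | "j = n" "j \<noteq> 0"
    using assms(2) by linarith
  then have "wall_dist n p (gen n j p) \<le> 4"
  proof cases
    case 1
    have p12: "0 < p 2" "p 2 < p 1" "p 1 < 1 / 2"
      using assms bounds[of 1] bounds[of 2] less[of 1 2] by auto
    have g: "gen n j p 1 = 1 - p 2" "gen n j p 2 = 1 - p 1" "\<And>k. k > 2 \<Longrightarrow> gen n j p k = p k"
      using 1 by (auto simp: gen_def)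
    have "wall_dist n p (gen n j p) \<le> (if 0 \<in> {1..n} then 4 else 0)
        + (if (1, 2) \<in> index_pairs n then 4 else 0)"
    proof (rule wall_dist_le)
      fix k assume k: "k \<in> {1..n}"
      then consider "k = 1" | "k = 2" | "k > 2"
        by force
      then have "wall_diff (p k) (gen n j p k) = 0"
        by cases (use bounds[OF k] p12 g in \<open>auto simp: wall_index_unit simp del: One_nat_def\<close>)
      then show "wall_diff (p k) (gen n j p k) \<le> (if k = 0 then 2 else 0)"
        by simp
    next
      fix a b assume ab: "1 \<le> a" "a < b" "b \<le> n"
      then have pab: "0 < p b" "p b < p a" "p a < 1 / 2"
        using bounds[of a] bounds[of b] less[of a b] by auto
      consider "a = 1" "b = 2" | "a = 1" "b > 2" | "a = 2" "b > 2" | "a > 2" "b > 2"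
        using ab by linarith
      then show "pair_dist p (gen n j p) (a, b) \<le> (if (a, b) = (1, 2) then 2 else 0)"
      proof cases
        case 1
        have "- (p 1 + p 2) + of_int 2 = 2 - (p 1 + p 2)"
          by simp
        \<comment> \<open>At the image the highest root takes a value between 1 and 2, so its wall
          index rises from 1 to 3.\<close>
        then have "wall_index (2 - (p 1 + p 2)) = - wall_index (p 1 + p 2) + 2 * 2"
          using wall_index_add_int[of "- (p 1 + p 2)" 2] by (simp only: wall_index_minus)
        moreover have "wall_index (p 1 + p 2) = 1"
          using p12 by (simp add: wall_index_unit del: One_nat_def)
        moreover have "1 - p 2 - (1 - p 1) = p 1 - p 2" "1 - p 2 + (1 - p 1) = 2 - (p 1 + p 2)"
          by simp_all
        ultimately have "pair_dist p (gen n j p) (1, 2) = 2"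
          by (simp only: pair_dist_def prod.case g)
        then show ?thesis
          using 1 by (simp del: One_nat_def)
      next
        case 2
        \<comment> \<open>This keeps \<open>1 - p 2 + p b\<close>, the sum of the coordinates
          \<open>a\<close> and \<open>b\<close> of the image, below 1.\<close>
        have "p b < p 2"
          using less[of 2 b] ab 2 by simp
        then have "pair_dist p (gen n j p) (a, b) = 0"
          using 2 g p12 pab
          by (auto simp: pair_dist_def wall_index_unit simp del: One_nat_def)
        then show ?thesis
          by simp
      next
        case 3
        then have "pair_dist p (gen n j p) (a, b) = 0"
          using g p12 pab
          by (auto simp: pair_dist_def wall_index_unit simp del: One_nat_def)
        then show ?thesis
          by simp
      next
        case 4
        then show ?thesis
          using g by (simp add: pair_dist_def)
      qed
    qed
    then show ?thesis
      by (simp split: if_splits)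
  next
    case 2
    define \<tau> where "\<tau> = Transposition.transpose j (j + 1)"
    have g: "gen n j p k = p (\<tau> k)" for k
      using 2 by (auto simp: gen_def \<tau>_def Transposition.transpose_def)
    have \<tau>_range: "\<tau> k \<in> {1..n}" if "k \<in> {1..n}" for k
      using 2 that by (auto simp: \<tau>_def Transposition.transpose_def)
    have "wall_dist n p (gen n j p) \<le> (if 0 \<in> {1..n} then 4 else 0)
        + (if (j, j + 1) \<in> index_pairs n then 4 else 0)"
    proof (rule wall_dist_le)
      fix k assume k: "k \<in> {1..n}"
      then show "wall_diff (p k) (gen n j p k) \<le> (if k = 0 then 2 else 0)"
        using bounds[OF k] bounds[OF \<tau>_range[OF k]] by (simp add: g wall_index_unit)
    next
      fix a b assume ab: "1 \<le> a" "a < b" "b \<le> n"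
      then have pab: "0 < p b" "p b < p a" "p a < 1 / 2"
        using bounds[of a] bounds[of b] less[of a b] by auto
      show "pair_dist p (gen n j p) (a, b) \<le> (if (a, b) = (j, j + 1) then 2 else 0)"
      proof (cases "(a, b) = (j, j + 1)")
        case True
        then have "\<tau> a = b" "\<tau> b = a"
          by (auto simp: \<tau>_def)
        then show ?thesis
          using True pab wall_index_minus[of "p a - p b"]
          by (simp add: pair_dist_def g wall_index_unit add.commute)
      next
        case False
        \<comment> \<open>An adjacent transposition reverses the order of no pair other than
          \<open>(j, j + 1)\<close>.\<close>
        then have "\<tau> a < \<tau> b"
          using ab by (auto simp: \<tau>_def Transposition.transpose_def)
        moreover have "\<tau> a \<in> {1..n}" "\<tau> b \<in> {1..n}"
          using ab \<tau>_range[of a] \<tau>_range[of b] by auto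
        ultimately have "0 < p (\<tau> b)" "p (\<tau> b) < p (\<tau> a)" "p (\<tau> a) < 1 / 2"
          using bounds[of "\<tau> a"] bounds[of "\<tau> b"] less[of "\<tau> a" "\<tau> b"] by auto
        then show ?thesis
          using pab by (simp add: pair_dist_def g wall_index_unit)
      qed
    qed
    then show ?thesis
      by (simp split: if_splits)
  next
    case 3
    have g: "gen n j p n = - p n" "\<And>k. k \<noteq> n \<Longrightarrow> gen n j p k = p k"
      using 3 by (auto simp: gen_def)
    have "wall_dist n p (gen n j p) \<le> (if n \<in> {1..n} then 4 else 0)
        + (if (0, 0) \<in> index_pairs n then 4 else 0)"
    proof (rule wall_dist_le)
      fix k assume k: "k \<in> {1..n}"
      then show "wall_diff (p k) (gen n j p k) \<le> (if k = n then 2 else 0)"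
        using bounds[OF k] g by (cases "k = n") (simp_all add: wall_index_minus wall_index_unit)
    next
      fix a b assume ab: "1 \<le> a" "a < b" "b \<le> n"
      then have pab: "0 < p b" "p b < p a" "p a < 1 / 2"
        using bounds[of a] bounds[of b] less[of a b] by auto
      \<comment> \<open>For \<open>b = n\<close> the sum and the difference merely trade values, and
        both lie between 0 and 1.\<close>
      have "pair_dist p (gen n j p) (a, b) = 0"
        using ab pab g by (cases "b = n") (simp_all add: pair_dist_def wall_index_unit)
      then show "pair_dist p (gen n j p) (a, b) \<le> (if (a, b) = (0, 0) then 2 else 0)"
        by simp
    qed
    then show ?thesis
      by (simp add: index_pairs_def split: if_splits)
  qed
  then show ?thesis
    by (simp add: p_def)
qed

text \<open>The flipped point stays in the fundamental alcove: its first coordinate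
  \<open>1 - p 1\<close> exceeds 1/2, while \<open>1 - p 1 + p b\<close> remains below 1 for
  \<open>b > 1\<close>.\<close>

lemma wall_dist_alcove_flip:
  "wall_dist n (alcove_point n) (flip n (alcove_point n)) \<le> 0"
proof -
  define p where "p = alcove_point n"
  note bounds = alcove_point_bounds[of _ n, folded p_def]
  note less = alcove_point_less[of _ _ n, folded p_def]
  have f: "flip n p 1 = 1 - p 1" "\<And>k. k \<noteq> 1 \<Longrightarrow> flip n p k = p k"
    using alcove_point_in_Rn[of n] by (auto simp: p_def flip_apply)
  have "wall_dist n p (flip n p) \<le> (if 0 \<in> {1..n} then 4 else 0)
        + (if (0, 0) \<in> index_pairs n then 4 else 0)"
  proof (rule wall_dist_le)
    fix k assume k: "k \<in> {1..n}"
    then have "wall_diff (p k) (flip n p k) = 0"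
      using bounds[OF k] f by (cases "k = 1") (auto simp: wall_index_unit simp del: One_nat_def)
    then show "wall_diff (p k) (flip n p k) \<le> (if k = 0 then 2 else 0)"
      by simp
  next
    fix a b assume ab: "1 \<le> a" "a < b" "b \<le> n"
    then have pab: "0 < p b" "p b < p a" "p a < 1 / 2"
      using bounds[of a] bounds[of b] less[of a b] by auto
    have "pair_dist p (flip n p) (a, b) = 0"
      using ab pab f
      by (cases "a = 1") (auto simp: pair_dist_def wall_index_unit simp del: One_nat_def)
    then show "pair_dist p (flip n p) (a, b) \<le> (if (a, b) = (0, 0) then 2 else 0)"
      by simp
  qed
  then show ?thesis
    by (simp add: p_def index_pairs_def split: if_splits)
qed

lemma wall_dist_self: "wall_dist n x x = 0"
  by (simp add: wall_dist_def pair_dist_def split_def)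

text \<open>The triangle inequality is applied at \<open>gen n j p\<close>. By invariance the rest
  of the word costs what it cost before, and the new letter adds at most 4.\<close>

lemma wall_dist_word_le:
  assumes "n \<ge> 2" "set js \<subseteq> {0..n}"
  shows "wall_dist n (alcove_point n) (foldr (gen n) js (alcove_point n)) \<le> 4 * int (length js)"
  using assms(2)
proof (induction js)
  case Nil
  then show ?case
    by (simp add: wall_dist_self)
next
  case (Cons j js)
  define p where "p = alcove_point n"
  define q where "q = foldr (gen n) js p"
  have "wall_dist n p (gen n j q) \<le> wall_dist n p (gen n j p) + wall_dist n (gen n j p) (gen n j q)"
    by (rule wall_dist_triangle)
  also have "wall_dist n (gen n j p) (gen n j q) = wall_dist n p q"
    using assms(1) Cons.prems by (simp add: wall_dist_gen)
  finally show ?case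
    using wall_dist_alcove_gen[of n j] assms(1) Cons by (simp add: p_def q_def)
qed

section \<open>Lengths: the criterion, the count for \<open>omega\<close>, the letters in the
  words\<close>

text \<open>Every word for the same element moves the alcove point to the same place, so
  \<open>wall_dist_word_le\<close> bounds its length from below by a quarter of the
  distance.\<close>

lemma coxeter_length_word:
  assumes "n \<ge> 2" "set js \<subseteq> {0..n}"
    and "4 * int (length js) \<le> wall_dist n (alcove_point n) (foldr (gen n) js (alcove_point n))"
  shows "coxeter_length n (word_prod n js) = length js"
  unfolding coxeter_length_def
proof (rule Least_equality)
  show "\<exists>ks. set ks \<subseteq> {0..n} \<and> length ks = length js \<and> word_prod n ks = word_prod n js"
    using assms(2) by blast
next
  fix r
  assume "\<exists>ks. set ks \<subseteq> {0..n} \<and> length ks = r \<and> word_prod n ks = word_prod n js"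
  then obtain ks where ks: "set ks \<subseteq> {0..n}" "length ks = r" "word_prod n ks = word_prod n js"
    by blast
  from fun_cong[OF ks(3), of "alcove_point n"]
  have "foldr (gen n) ks (alcove_point n) = foldr (gen n) js (alcove_point n)"
    using assms(1,2) ks(1) alcove_point_in_Rn by (simp add: word_prod_eq(1))
  then have "4 * int (length js) \<le> 4 * int (length ks)"
    using wall_dist_word_le[OF assms(1) ks(1)] assms(3) by simp
  then show "length js \<le> r"
    using ks(2) by simp
qed

text \<open>Split by the first entry: if it is at most \<open>i\<close>, any of the other
  \<open>n - 1\<close> indices may follow; otherwise the second entry must be at most
  \<open>i\<close>.\<close>

lemma card_index_pairs_touching:
  assumes "i \<le> n"
  shows "card {(a, b) \<in> index_pairs n. a \<le> i \<or> b \<le> i} = i * (n - 1) + (n - i) * i"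
proof -
  have "{(a, b) \<in> index_pairs n. a \<le> i \<or> b \<le> i}
      = Sigma {1..i} (\<lambda>a. {1..n} - {a}) \<union> {i+1..n} \<times> {1..i}"
    using assms by (auto simp: index_pairs_def)
  also have "card \<dots> = card (Sigma {1..i} (\<lambda>a. {1..n} - {a})) + card ({i+1..n} \<times> {1..i})"
    by (rule card_Un_disjoint) auto
  also have "card (Sigma {1..i} (\<lambda>a. {1..n} - {a})) = (\<Sum>a=1..i. card ({1..n} - {a}))"
    by (rule card_SigmaI) auto
  also have "\<dots> = (\<Sum>a=1..i. n - 1)"
    using assms by (intro sum.cong) auto
  finally show ?thesis
    by (simp add: card_cartesian_product)
qed

text \<open>Valid at every point, since translating by an integer changes a wall index by exactly
  twice that integer. A pair meeting \<open>{1..i}\<close> contributes 4 in either case: with one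
  entry in the range, sum and difference both shift by 1 up to sign; with two, the sum shifts by 2
  and the difference not at all.\<close>

lemma wall_dist_omega:
  assumes "i \<le> n" "x \<in> Rn n"
  shows "wall_dist n x (omega n i x) = 4 * int (i * (2 * n - i))"
proof -
  define l :: "nat \<Rightarrow> int" where "l k = (if k \<le> i then 1 else 0)" for k
  have y: "omega n i x k = x k + of_int (l k)" if "k \<ge> 1" for k
    using assms that by (simp add: omega_eq l_def)
  have I: "{1..n} \<inter> {k. k \<le> i} = {1..i}"
    using assms(1) by auto
  have "(\<Sum>k=1..n. wall_diff (x k) (omega n i x k)) = (\<Sum>k=1..n. if k \<le> i then 2 else 0)"
    by (rule sum.cong) (auto simp: y wall_index_add_int l_def)
  also have "\<dots> = 2 * int i"
    using I by (simp add: sum.If_cases)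
  finally have S: "(\<Sum>k=1..n. wall_diff (x k) (omega n i x k)) = 2 * int i" .
  have "pair_dist x (omega n i x) (a, b) = (if a \<le> i \<or> b \<le> i then 4 else 0)"
    if "a \<ge> 1" "b \<ge> 1" for a b
  proof -
    have "omega n i x a - omega n i x b = (x a - x b) + of_int (l a - l b)"
      "omega n i x a + omega n i x b = (x a + x b) + of_int (l a + l b)"
      using that by (simp_all add: y)
    then show ?thesis
      unfolding pair_dist_def prod.case by (simp only: wall_index_add_int) (auto simp: l_def)
  qed
  then have "sum (pair_dist x (omega n i x)) (index_pairs n)
      = (\<Sum>q\<in>index_pairs n. if q \<in> {(a, b). a \<le> i \<or> b \<le> i} then 4 else 0)"
    by (intro sum.cong) (auto simp: index_pairs_def simp del: One_nat_def split del: if_split)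
  also have "\<dots> = 4 * int (card (index_pairs n \<inter> {(a, b). a \<le> i \<or> b \<le> i}))"
    by (simp add: sum.If_cases finite_index_pairs)
  also have "index_pairs n \<inter> {(a, b). a \<le> i \<or> b \<le> i} = {(a, b) \<in> index_pairs n. a \<le> i \<or> b \<le> i}"
    by auto
  finally have P: "sum (pair_dist x (omega n i x)) (index_pairs n) = 4 * int (i * (n - 1) + (n - i) * i)"
    using assms(1) by (simp add: card_index_pairs_touching)
  have total: "i + (i * (n - 1) + (n - i) * i) = i * (2 * n - i)"
  proof -
    obtain m where "n = i + m"
      using assms(1) le_Suc_ex by blast
    then show ?thesis
      by (cases i) (simp_all add: algebra_simps)
  qed
  show ?thesis
    unfolding wall_dist_def S P total[symmetric] by (simp only: of_nat_add distrib_left)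
qed

lemma length_seg: "length (seg k l) = Suc l - k"
  by (simp add: seg_def del: upt_Suc)

lemma length_staircase:
  assumes "1 \<le> i"
  shows "length (staircase n i) = (n - i) * i"
proof -
  have "length (staircase n i) = (\<Sum>k\<leftarrow>rev [1..<Suc (n - i)]. i)"
    unfolding staircase_def length_concat map_map
    using assms by (intro arg_cong[where f = sum_list] map_cong) (auto simp: length_seg)
  then show ?thesis
    by (simp add: sum_list_triv del: upt_Suc)
qed

lemma length_block_power: "n \<ge> 1 \<Longrightarrow> length (block_power n t) = t * (2 * n)"
  by (simp add: block_power_def length_concat sum_list_replicate length_seg)

theorem proposition3p5:
  fixes n i :: nat
  assumes "n \<ge> 2" and "1 \<le> i" and "i \<le> n"
  shows "(odd i \<longrightarrow>
            omega n i = pi1 n \<otimes>\<^bsub>ext_weyl n\<^esub>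
              word_prod n (seg 1 n @ block_power n ((i - 1) div 2) @ staircase n i)
          \<and> reduced_expr n (pi1 n) (seg 1 n @ block_power n ((i - 1) div 2) @ staircase n i))
       \<and> (even i \<longrightarrow>
            omega n i = word_prod n (block_power n (i div 2) @ staircase n i)
          \<and> reduced_expr n \<one>\<^bsub>ext_weyl n\<^esub> (block_power n (i div 2) @ staircase n i))"
proof -
  define p where "p = alcove_point n"
  have p: "p \<in> Rn n"
    by (simp add: p_def alcove_point_in_Rn)
  \<comment> \<open>The factor \<open>u\<close> does not affect the length, so it suffices to bound
    the displacement caused by the word alone.\<close>
  have reduced: "reduced_expr n u js"
    if "u \<in> Lambda n" "set js \<subseteq> {0..n}" "length js = i * (2 * n - i)"
      "4 * int (i * (2 * n - i)) \<le> wall_dist n p (foldr (gen n) js p)" for u js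
  proof -
    have "coxeter_length n (word_prod n js) = length js"
      by (rule coxeter_length_word[OF assms(1) that(2)]) (use that(3,4) in \<open>simp only: p_def\<close>)
    then show ?thesis
      unfolding reduced_expr_def
      using that(1,2) ext_length_Lambda_mult[OF assms(1) that(1) word_prod_in_aff_weyl[OF assms(1) that(2)]]
      by simp
  qed
  \<comment> \<open>In both parities the letters before the staircase number \<open>i * n\<close>:
    each block has \<open>2 * n\<close> of them, and for odd \<open>i\<close> the leading segment
    adds \<open>n\<close>.\<close>
  have total: "i * n + (n - i) * i = i * (2 * n - i)"
  proof -
    obtain m where "n = i + m"
      using assms(3) le_Suc_ex by blast
    then show ?thesis
      by (simp add: algebra_simps)
  qed
  have sets: "set (seg 1 n) \<subseteq> {0..n}" "set (block_power n t) \<subseteq> {0..n}" "set (staircase n i) \<subseteq> {0..n}" for t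
    using set_staircase[OF assms(2,3)] set_block_power by (auto simp: set_seg)
  show ?thesis
  proof (intro conjI impI)
    assume i: "odd i"
    let ?js = "seg 1 n @ block_power n ((i - 1) div 2) @ staircase n i"
    have js: "set ?js \<subseteq> {0..n}"
      using sets by auto
    show "omega n i = pi1 n \<otimes>\<^bsub>ext_weyl n\<^esub> word_prod n ?js"
      using omega_odd_eq_flip_mult[OF assms i] assms(1) by (simp add: pi1_eq_flip)
    show "reduced_expr n (pi1 n) ?js"
    proof (rule reduced)
      show "pi1 n \<in> Lambda n"
        by (simp add: Lambda_def)
      show "set ?js \<subseteq> {0..n}"
        by (rule js)
      obtain t where "i = 2 * t + 1"
        using i by (elim oddE)
      then show "length ?js = i * (2 * n - i)"
        using assms total
        by (simp add: length_seg length_block_power length_staircase algebra_simps)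
      define q where "q = foldr (gen n) ?js p"
      have q: "q \<in> Rn n"
        unfolding q_def by (rule foldr_gen_in_Rn[OF assms(1) js p])
      have "omega n i p = flip n q"
        using omega_odd_eq_flip_mult[OF assms i] p assms(1) word_prod_eq[OF assms(1) js]
          Aff_mult[OF flip_in_Aff[of n] word_prod_eq(2)[OF assms(1) js]]
        by (simp add: compose_def q_def del: foldr_append)
      then have "4 * int (i * (2 * n - i)) = wall_dist n p (flip n q)"
        using wall_dist_omega[OF assms(3) p] by simp
      \<comment> \<open>The displacement is known for \<open>omega n i p = flip n q\<close>, but the
        bound is wanted for \<open>q\<close>. As \<open>flip n p\<close> is at distance 0 from
        \<open>p\<close>, removing the flip loses nothing.\<close>
      also have "\<dots> \<le> wall_dist n p (flip n p) + wall_dist n (flip n p) (flip n q)"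
        by (rule wall_dist_triangle)
      also have "\<dots> \<le> wall_dist n p q"
        using wall_dist_alcove_flip[of n] wall_dist_flip[OF p q] by (simp add: p_def)
      finally show "4 * int (i * (2 * n - i)) \<le> wall_dist n p (foldr (gen n) ?js p)"
        by (simp only: q_def)
    qed
  next
    assume i: "even i"
    let ?js = "block_power n (i div 2) @ staircase n i"
    have js: "set ?js \<subseteq> {0..n}"
      using sets by auto
    show eq: "omega n i = word_prod n ?js"
      by (rule omega_even_eq_word_prod[OF assms i])
    show "reduced_expr n \<one>\<^bsub>ext_weyl n\<^esub> ?js"
    proof (rule reduced)
      show "\<one>\<^bsub>ext_weyl n\<^esub> \<in> Lambda n"
        by (simp add: Lambda_def)
      show "set ?js \<subseteq> {0..n}"
        by (rule js)
      obtain t where "i = 2 * t"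
        using i by (elim evenE)
      then show "length ?js = i * (2 * n - i)"
        using assms total
        by (simp add: length_block_power length_staircase algebra_simps)
      have "omega n i p = foldr (gen n) ?js p"
        unfolding eq word_prod_eq(1)[OF assms(1) js] using p by simp
      then show "4 * int (i * (2 * n - i)) \<le> wall_dist n p (foldr (gen n) ?js p)"
        using wall_dist_omega[OF assms(3) p] by simp
    qed
  qed
qed

end
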